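(* Let $A \subset \mathbb{R}^d$ be a bounded set and let $t \in \mathbb{R}^d$ be a translation vector. Then $$\mathcal{H}^d\bigl(A \bigtriangleup (A+t)\bigr) \le |t| \, \mathcal{H}^{d-1}(\partial A).$$
   Context: Notation: $|\cdot|$ is the Euclidean norm; $A+t=\{a+t : a\in A\}$; $A \bigtriangleup B = (A\setminus B)\cup(B\setminus A)$; the boundary $\partial A$ is $\operatorname{cl}(A)\setminus\operatorname{int}(A)$. Hausdorff measure: for an integer $0\le k\le d$, let $\omega_k$ denote the volume of the Euclidean unit ball in $\mathbb{R}^k$ (with $\omega_0=1$). For an arbitrary set $A\subset\mathbb{R}^d$ (no measurability required) and $\delta>0$ put $$\mathcal{H}^k_\delta(A)=\omega_k 2^{-k}\inf\Bigl\{\sum_{j=0}^\infty(\operatorname{diam}B_j)^k : B_j\subset\mathbb{R}^d,\ \operatorname{diam}B_j\le\delta \text{ for all } j,\ A\subset\bigcup_{j=0}^\infty B_j\Bigr\},$$ and $\mathcal{H}^k(A)=\lim_{\delta\to 0^+}\mathcal{H}^k_\delta(A)\in[0,\infty]$ (for $k=0$, $(\operatorname{diam} B)^0$ is $1$ for nonempty $B$ and $0$ for $B=\emptyset$, so $\mathcal{H}^0$ is counting measure). With this normalization $\mathcal{H}^d$ agrees with Lebesgue measure on Lebesgue measurable subsets of $\mathbb{R}^d$. *)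

theory Defs
  imports "HOL-Analysis.Analysis"
begin

text \<open>
  The library's \<^const>\<open>diameter\<close> is an unspecified real number on unbounded sets, so the
  condition that a covering set has diameter at most \<open>\<delta>\<close> has to include boundedness.
  The case distinction in \<open>diam_pow\<close> is the convention \<open>(diam {})^0 = 0\<close>.
\<close>

definition diam_pow :: "nat \<Rightarrow> 'a::metric_space set \<Rightarrow> ennreal" where
  "diam_pow k B = (if B = {} then 0 else ennreal (diameter B ^ k))"

definition hausdorff_pre :: "nat \<Rightarrow> real \<Rightarrow> 'a::metric_space set \<Rightarrow> ennreal" where
  "hausdorff_pre k \<delta> A =
     ennreal (unit_ball_vol (real k) / 2 ^ k) *
     (INF B \<in> {B :: nat \<Rightarrow> 'a set.
                 (\<forall>j. bounded (B j) \<and> diameter (B j) \<le> \<delta>) \<and> A \<subseteq> (\<Union>j. B j)}.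
        \<Sum>j. diam_pow k (B j))"

definition hausdorff_measure :: "nat \<Rightarrow> 'a::metric_space set \<Rightarrow> ennreal" where
  "hausdorff_measure k A = Lim (at_right 0) (\<lambda>\<delta>. hausdorff_pre k \<delta> A)"

lemma hausdorff_pre_antimono:
  assumes "\<delta> \<le> \<epsilon>"
  shows "hausdorff_pre k \<epsilon> A \<le> hausdorff_pre k \<delta> A"
  unfolding hausdorff_pre_def
  by (intro mult_left_mono INF_superset_mono) (use assms in \<open>auto intro: order_trans\<close>)

text \<open>The limit defining \<^const>\<open>hausdorff_measure\<close> exists for every set.\<close>

lemma tendsto_hausdorff_pre_SUP:
  "((\<lambda>\<delta>. hausdorff_pre k \<delta> A) \<longlongrightarrow> (SUP \<delta>\<in>{0<..}. hausdorff_pre k \<delta> A)) (at_right 0)"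
proof (rule increasing_tendsto)
  show "\<forall>\<^sub>F \<delta> in at_right 0. hausdorff_pre k \<delta> A \<le> (SUP \<delta>\<in>{0<..}. hausdorff_pre k \<delta> A)"
    using eventually_at_right_less[of "0::real"]
    by eventually_elim (auto intro: SUP_upper)
next
  fix x assume "x < (SUP \<delta>\<in>{0<..}. hausdorff_pre k \<delta> A)"
  then obtain \<epsilon> where \<epsilon>: "\<epsilon> > 0" "x < hausdorff_pre k \<epsilon> A"
    by (auto simp: less_SUP_iff)
  have "\<forall>\<^sub>F \<delta> in at_right 0. \<delta> < \<epsilon>"
    using \<epsilon>(1) by (auto simp: eventually_at_right)
  then show "\<forall>\<^sub>F \<delta> in at_right 0. x < hausdorff_pre k \<delta> A"
    by eventually_elim (meson \<epsilon>(2) hausdorff_pre_antimono less_imp_le less_le_trans)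
qed

lemma hausdorff_measure_eq_SUP:
  "hausdorff_measure k A = (SUP \<delta>\<in>{0<..}. hausdorff_pre k \<delta> A)"
  unfolding hausdorff_measure_def
  by (rule tendsto_Lim[OF _ tendsto_hausdorff_pre_SUP]) simp

lemma tendsto_hausdorff_measure:
  "((\<lambda>\<delta>. hausdorff_pre k \<delta> A) \<longlongrightarrow> hausdorff_measure k A) (at_right 0)"
  unfolding hausdorff_measure_eq_SUP by (rule tendsto_hausdorff_pre_SUP)

end

theory Submission
  imports Defs
begin

text \<open>
  If \<open>x\<close> belongs to exactly one of \<open>A\<close> and \<open>A + t\<close>, then exactly one of \<open>x\<close> and \<open>x - t\<close> lies
  in \<open>A\<close>, so the connected segment between them meets the boundary of \<open>A\<close>. Hence
  \<open>A \<triangle> (A + t)\<close> is contained in the set swept out by the boundary while it is translated along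
  \<open>t\<close> (\<open>sym_diff_translate_subset_sweep\<close>), and it remains to show that sweeping an arbitrary set
  \<open>B\<close> along \<open>t\<close> produces a set of \<open>d\<close>-dimensional measure at most \<open>|t|\<close> times the
  \<open>(d - 1)\<close>-dimensional measure of \<open>B\<close> (\<open>hausdorff_measure_sweep\<close>).

  Cover \<open>B\<close> by sets of diameter at most \<open>\<delta>\<close>. Such a piece of diameter \<open>D\<close>, swept along \<open>t\<close>, stays
  inside a cylinder with axis \<open>t\<close> and length at most \<open>|t| + \<delta>\<close>, whose base is the closure of the projection of
  the piece to the orthogonal complement of \<open>t\<close>. The base again has diameter at most \<open>D\<close>. By the isodiametric
  inequality in \<open>d - 1\<close> dimensions its volume is at most that of a ball of radius \<open>D / 2\<close>, which is
  exactly the term that the piece contributes to the premeasure of \<open>B\<close>. Summing over the pieces and letting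
  \<open>\<delta>\<close> tend to \<open>0\<close> gives the bound. It is because of the isodiametric inequality that the constant is \<open>|t|\<close>
  and not a dimensional multiple of it.

  Two facts support this argument. The isodiametric inequality (\<open>isodiametric_inequality\<close>) is proved
  by Steiner symmetrisation in each coordinate, on products of copies of the real line, since the
  dimension \<open>d - 1\<close> has no type of its own. The volume of the cylinders is Lebesgue measure, and
  \<open>hausdorff_measure_le_lborel\<close> passes from it to Hausdorff measure by Vitali's covering theorem.
  Lebesgue measure factors along coordinate directions only, so the direction \<open>t\<close> is first
  moved to a coordinate axis by a reflection; Hausdorff measure, defined by diameters, is visibly
  invariant under isometries.
\<close>

section \<open>The isodiametric inequality\<close>

text \<open>
  The one-dimensional heart of Steiner symmetrisation: replacing two sets of reals by centred
  intervals of the same lengths cannot push points further apart. If \<open>S\<close> and \<open>T\<close> span \<open>[a, b]\<close> and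
  \<open>[c, d]\<close>, the new distance is at most \<open>((b - a) + (d - c)) / 2 = ((b - c) + (d - a)) / 2\<close>, a mean of two
  quantities that bound distances between points of \<open>S\<close> and points of \<open>T\<close>.
\<close>

lemma close_of_long_linear_sets:
  fixes S T :: "real set"
  assumes p: "2 * ennreal \<bar>p\<bar> < emeasure lborel S"
    and q: "2 * ennreal \<bar>q\<bar> < emeasure lborel T"
    and near: "\<And>s u. s \<in> S \<Longrightarrow> u \<in> T \<Longrightarrow> \<bar>s - u\<bar> \<le> M"
  shows "\<bar>p - q\<bar> \<le> M"
proof -
  obtain s0 u0 where s0: "s0 \<in> S" and u0: "u0 \<in> T"
    using p q by (metis emeasure_empty ex_in_conv not_less_zero)
  have "\<bar>s\<bar> \<le> \<bar>u0\<bar> + M" if "s \<in> S" for s using near[OF that u0] by linarith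
  then have "bounded S" by (auto simp: bounded_iff)
  then have bS: "bdd_above S" "bdd_below S" by (auto intro: bounded_imp_bdd_above bounded_imp_bdd_below)
  have "\<bar>u\<bar> \<le> \<bar>s0\<bar> + M" if "u \<in> T" for u using near[OF s0 that] by linarith
  then have "bounded T" by (auto simp: bounded_iff)
  then have bT: "bdd_above T" "bdd_below T" by (auto intro: bounded_imp_bdd_above bounded_imp_bdd_below)
  have len: "2 * \<bar>r\<bar> \<le> Sup X - Inf X"
    if "2 * ennreal \<bar>r\<bar> < emeasure lborel X" "bdd_above X" "bdd_below X" "X \<noteq> {}" for r and X :: "real set"
  proof -
    have "Inf X \<le> Sup X" using that by (intro cInf_le_cSup) auto
    have "X \<subseteq> {Inf X..Sup X}" using that by (auto intro: cInf_lower cSup_upper)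
    then have "emeasure lborel X \<le> emeasure lborel {Inf X..Sup X}" by (intro emeasure_mono) auto
    also have "\<dots> = ennreal (Sup X - Inf X)" using \<open>Inf X \<le> Sup X\<close> by simp
    finally have "ennreal (2 * \<bar>r\<bar>) < ennreal (Sup X - Inf X)"
      using that(1) by (simp add: ennreal_mult')
    then show ?thesis by (simp add: ennreal_less_iff)
  qed
  have "Sup S \<le> Inf T + M"
  proof (rule cSup_least)
    fix s assume "s \<in> S"
    have "s - M \<le> Inf T" using u0 near[OF \<open>s \<in> S\<close>] by (intro cInf_greatest) fastforce+
    then show "s \<le> Inf T + M" by simp
  qed (use s0 in auto)
  moreover have "Sup T \<le> Inf S + M"
  proof (rule cSup_least)
    fix u assume "u \<in> T"
    have "u - M \<le> Inf S" using s0 near[OF _ \<open>u \<in> T\<close>] by (intro cInf_greatest) fastforce+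
    then show "u \<le> Inf S + M" by simp
  qed (use u0 in auto)
  moreover have "2 * \<bar>p\<bar> \<le> Sup S - Inf S" "2 * \<bar>q\<bar> \<le> Sup T - Inf T"
    using len p q bS bT s0 u0 by blast+
  ultimately show ?thesis by linarith
qed

definition slice_length :: "'i \<Rightarrow> ('i \<Rightarrow> real) set \<Rightarrow> ('i \<Rightarrow> real) \<Rightarrow> ennreal" where
  "slice_length i K x = emeasure lborel {s. x(i := s) \<in> K}"

text \<open>
  Every line in direction \<open>i\<close> meets the symmetrised set in the centred open interval as long as
  the slice of \<open>K\<close>. Because the inequality is strict, the lines that miss \<open>K\<close> contribute nothing; the
  set of lines that meet \<open>K\<close>, a projection and possibly not measurable, does not enter.
\<close>

definition steiner :: "'i set \<Rightarrow> 'i \<Rightarrow> ('i \<Rightarrow> real) set \<Rightarrow> ('i \<Rightarrow> real) set" where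
  "steiner I i K = {x \<in> space (Pi\<^sub>M I (\<lambda>_. lborel)). 2 * ennreal \<bar>x i\<bar> < slice_length i K x}"

text \<open>
  Two index sets \<open>J\<close> are of interest: with \<open>J = I\<close> the slice length is compared with the coordinate
  \<open>x i\<close> in the definition of the symmetrisation, with \<open>J = I - {i}\<close> it is the inner integral in
  Fubini's theorem.
\<close>

lemma measurable_slice_length:
  assumes K: "K \<in> sets (Pi\<^sub>M I (\<lambda>_. lborel))" and i: "i \<in> I" and J: "J = I \<or> I = insert i J"
  shows "slice_length i K \<in> borel_measurable (Pi\<^sub>M J (\<lambda>_. lborel))"
    and "x \<in> space (Pi\<^sub>M J (\<lambda>_. lborel)) \<Longrightarrow> {s. x(i := s) \<in> K} \<in> sets lborel"
proof -
  have I: "insert i J = I" using i J by auto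
  have upd [measurable]: "(\<lambda>(x, s). x(i := s)) \<in> Pi\<^sub>M J (\<lambda>_. lborel) \<Otimes>\<^sub>M lborel \<rightarrow>\<^sub>M Pi\<^sub>M I (\<lambda>_. lborel)"
    using measurable_add_dim[of i J "\<lambda>_. lborel"] unfolding I by simp
  have Q: "(\<lambda>(x, s). x(i := s)) -` K \<inter> space (Pi\<^sub>M J (\<lambda>_. lborel) \<Otimes>\<^sub>M (lborel :: real measure))
     \<in> sets (Pi\<^sub>M J (\<lambda>_. lborel) \<Otimes>\<^sub>M lborel)" (is "?Q \<in> _")
    by (rule measurable_sets[OF upd K])
  have sl: "Pair x -` ?Q = {s. x(i := s) \<in> K}" if "x \<in> space (Pi\<^sub>M J (\<lambda>_. lborel))" for x
    using that by (auto simp: space_pair_measure)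
  show "slice_length i K \<in> borel_measurable (Pi\<^sub>M J (\<lambda>_. lborel))"
    using lborel.measurable_emeasure_Pair[OF Q]
    by (subst measurable_cong[of _ _ "\<lambda>x. emeasure lborel (Pair x -` ?Q)"])
      (simp_all only: slice_length_def sl)
  show "{s. x(i := s) \<in> K} \<in> sets lborel" if "x \<in> space (Pi\<^sub>M J (\<lambda>_. lborel))"
    using sets_Pair1[OF Q, of x] sl[OF that] by simp
qed

lemma sets_steiner:
  assumes [measurable]: "K \<in> sets (Pi\<^sub>M I (\<lambda>_. lborel))" and i: "i \<in> I"
  shows "steiner I i K \<in> sets (Pi\<^sub>M I (\<lambda>_. lborel))"
proof -
  have [measurable]: "slice_length i K \<in> borel_measurable (Pi\<^sub>M I (\<lambda>_. lborel))"
    using measurable_slice_length(1)[OF assms] by simp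
  have [measurable]: "(\<lambda>x. x i) \<in> borel_measurable (Pi\<^sub>M I (\<lambda>_. lborel :: real measure))"
    using measurable_component_singleton[OF i, of "\<lambda>_. lborel"] by simp
  show ?thesis unfolding steiner_def by measurable
qed

lemma emeasure_PiM_slices:
  assumes K: "K \<in> sets (Pi\<^sub>M (insert i J) (\<lambda>_. lborel))" and J: "finite J" "i \<notin> J"
  shows "emeasure (Pi\<^sub>M (insert i J) (\<lambda>_. lborel)) K = (\<integral>\<^sup>+x. slice_length i K x \<partial>Pi\<^sub>M J (\<lambda>_. lborel))"
proof -
  interpret product_sigma_finite "\<lambda>_. lborel :: real measure" by standard
  have "emeasure (Pi\<^sub>M (insert i J) (\<lambda>_. lborel)) K = (\<integral>\<^sup>+x. indicator K x \<partial>Pi\<^sub>M (insert i J) (\<lambda>_. lborel))"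
    using K by simp
  also have "\<dots> = (\<integral>\<^sup>+x. \<integral>\<^sup>+s. indicator K (x(i := s)) \<partial>lborel \<partial>Pi\<^sub>M J (\<lambda>_. lborel))"
    using K J by (subst product_nn_integral_insert) auto
  also have "\<dots> = (\<integral>\<^sup>+x. slice_length i K x \<partial>Pi\<^sub>M J (\<lambda>_. lborel))"
  proof (rule nn_integral_cong)
    fix x assume "x \<in> space (Pi\<^sub>M J (\<lambda>_. lborel :: real measure))"
    then have [measurable]: "{s. x(i := s) \<in> K} \<in> sets lborel"
      using measurable_slice_length(2)[OF K] by auto
    have "(\<lambda>s. indicator K (x(i := s)) :: ennreal) = indicator {s. x(i := s) \<in> K}"
      by (auto simp: indicator_def)
    then show "(\<integral>\<^sup>+s. indicator K (x(i := s)) \<partial>lborel) = slice_length i K x"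
      by (simp add: slice_length_def del: sets_lborel)
  qed
  finally show ?thesis .
qed

lemma emeasure_centred_interval:
  "emeasure lborel {s. 2 * ennreal \<bar>s\<bar> < m} = m"
proof (cases m)
  case (real r)
  have "2 * ennreal \<bar>s\<bar> < m \<longleftrightarrow> s \<in> {- r / 2 <..< r / 2}" for s
  proof -
    have "2 * ennreal \<bar>s\<bar> = ennreal (2 * \<bar>s\<bar>)" by (simp add: ennreal_mult')
    then show ?thesis using real by (auto simp: ennreal_less_iff)
  qed
  then have "{s. 2 * ennreal \<bar>s\<bar> < m} = {- r / 2 <..< r / 2}" by blast
  then show ?thesis using real by simp
next
  case top
  have "2 * ennreal \<bar>s\<bar> < top" for s by (simp add: ennreal_mult_less_top)
  then show ?thesis using top emeasure_lborel_UNIV[where 'a=real] by simp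
qed

text \<open>
  Cavalieri's principle: symmetrisation changes the slices in direction \<open>i\<close> but not their lengths.
\<close>

lemma emeasure_steiner:
  assumes K: "K \<in> sets (Pi\<^sub>M I (\<lambda>_. lborel))" and I: "finite I" "i \<in> I"
  shows "emeasure (Pi\<^sub>M I (\<lambda>_. lborel)) (steiner I i K) = emeasure (Pi\<^sub>M I (\<lambda>_. lborel)) K"
proof -
  define J where "J = I - {i}"
  have IJ: "I = insert i J" and J: "finite J" "i \<notin> J" using I by (auto simp: J_def)
  have "slice_length i (steiner I i K) x = slice_length i K x"
    if "x \<in> space (Pi\<^sub>M J (\<lambda>_. lborel))" for x
  proof -
    have "{s. x(i := s) \<in> steiner I i K} = {s. 2 * ennreal \<bar>s\<bar> < slice_length i K x}"
      using that by (auto simp: steiner_def IJ space_PiM PiE_def extensional_def slice_length_def)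
    then show ?thesis
      by (simp add: slice_length_def[of i "steiner I i K"] emeasure_centred_interval)
  qed
  then show ?thesis
    using sets_steiner[OF K I(2)] K J unfolding IJ
    by (simp add: emeasure_PiM_slices cong: nn_integral_cong)
qed

text \<open>
  Points of a product space are functions, and the type of functions does not carry the Euclidean
  metric in the coordinates \<open>I\<close>; the diameter bound is therefore spelled out.
\<close>

definition l2_diameter_le :: "'i set \<Rightarrow> ('i \<Rightarrow> real) set \<Rightarrow> real \<Rightarrow> bool" where
  "l2_diameter_le I K D \<longleftrightarrow> (\<forall>x\<in>K. \<forall>y\<in>K. (\<Sum>j\<in>I. (x j - y j)\<^sup>2) \<le> D\<^sup>2)"

text \<open>
  For fixed values of the other coordinates the bound \<open>D\<close> on distances amounts to a bound
  \<open>sqrt (D\<^sup>2 - w)\<close> on the distance between points of two slices, to which the one-dimensional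
  comparison applies.
\<close>

lemma steiner_l2_diameter_le:
  assumes I: "finite I" "i \<in> I" and D: "l2_diameter_le I K D"
  shows "l2_diameter_le I (steiner I i K) D"
  unfolding l2_diameter_le_def
proof (intro ballI)
  fix x y assume x: "x \<in> steiner I i K" and y: "y \<in> steiner I i K"
  define w where "w = (\<Sum>j\<in>I-{i}. (x j - y j)\<^sup>2)"
  have split: "(\<Sum>j\<in>I. (f j - g j)\<^sup>2) = (f i - g i)\<^sup>2 + (\<Sum>j\<in>I-{i}. (f j - g j)\<^sup>2)" for f g :: "_ \<Rightarrow> real"
    using I by (rule sum.remove)
  \<comment> \<open>Here \<open>w\<close> is the part of the squared distance that symmetrisation in direction \<open>i\<close> leaves alone.\<close>
  have near: "(s - u)\<^sup>2 \<le> D\<^sup>2 - w" if "x(i := s) \<in> K" "y(i := u) \<in> K" for s u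
    using D that split[of "x(i := s)" "y(i := u)"] unfolding l2_diameter_le_def w_def by fastforce
  have "\<bar>x i - y i\<bar> \<le> sqrt (D\<^sup>2 - w)"
  proof (rule close_of_long_linear_sets)
    show "2 * ennreal \<bar>x i\<bar> < emeasure lborel {s. x(i := s) \<in> K}"
         "2 * ennreal \<bar>y i\<bar> < emeasure lborel {s. y(i := s) \<in> K}"
      using x y by (auto simp: steiner_def slice_length_def)
    show "\<bar>s - u\<bar> \<le> sqrt (D\<^sup>2 - w)" if "s \<in> {s. x(i := s) \<in> K}" "u \<in> {s. y(i := s) \<in> K}" for s u
      using near[of s u] that by (simp add: real_le_rsqrt)
  qed
  then have "sqrt ((x i - y i)\<^sup>2) \<le> sqrt (D\<^sup>2 - w)" by simp
  then have "(x i - y i)\<^sup>2 \<le> D\<^sup>2 - w" by (simp only: real_sqrt_le_iff)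
  then show "(\<Sum>j\<in>I. (x j - y j)\<^sup>2) \<le> D\<^sup>2" using split[of x y] by (simp add: w_def)
qed

definition reflection_invariant :: "'i \<Rightarrow> ('i \<Rightarrow> real) set \<Rightarrow> bool" where
  "reflection_invariant j K \<longleftrightarrow> (\<forall>x\<in>K. x(j := - x j) \<in> K)"

text \<open>
  A symmetrisation keeps the symmetries obtained before it, which is what makes it possible to
  symmetrise in one coordinate after another.
\<close>

lemma steiner_reflection_invariant:
  assumes "i \<in> I" "j \<in> I" "j = i \<or> reflection_invariant j K"
  shows "reflection_invariant j (steiner I i K)"
proof (cases "j = i")
  case True
  then show ?thesis using assms(1)
    by (auto simp: reflection_invariant_def steiner_def slice_length_def space_PiM PiE_def extensional_def)
next
  case False
  then have inv: "x(j := - x j) \<in> K" if "x \<in> K" for x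
    using assms that by (auto simp: reflection_invariant_def)
  have "x(j := - x j, i := s) \<in> K \<longleftrightarrow> x(i := s) \<in> K" for x s
    using inv[of "x(i := s)"] inv[of "x(j := - x j, i := s)"] False
    by (auto simp: fun_upd_twist[of i j] fun_upd_idem)
  then have "slice_length i K (x(j := - x j)) = slice_length i K x" for x
    by (simp add: slice_length_def)
  then show ?thesis using False assms(2)
    by (auto simp: reflection_invariant_def steiner_def space_PiM PiE_def extensional_def)
qed

lemma symmetric_rearrangement_exists:
  assumes K: "K \<in> sets (Pi\<^sub>M I (\<lambda>_. lborel))" and I: "finite I" and D: "l2_diameter_le I K D"
  obtains K' where "K' \<in> sets (Pi\<^sub>M I (\<lambda>_. lborel))"
    "emeasure (Pi\<^sub>M I (\<lambda>_. lborel)) K' = emeasure (Pi\<^sub>M I (\<lambda>_. lborel)) K"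
    "l2_diameter_le I K' D" "\<And>j. j \<in> I \<Longrightarrow> reflection_invariant j K'"
proof -
  have "\<exists>K' \<in> sets (Pi\<^sub>M I (\<lambda>_. lborel)).
      emeasure (Pi\<^sub>M I (\<lambda>_. lborel)) K' = emeasure (Pi\<^sub>M I (\<lambda>_. lborel)) K \<and>
      l2_diameter_le I K' D \<and> (\<forall>j\<in>J. reflection_invariant j K')" if "finite J" "J \<subseteq> I" for J
    using that
  proof (induction J rule: finite_induct)
    case empty
    then show ?case using K D by auto
  next
    case (insert i J)
    then obtain K' where K': "K' \<in> sets (Pi\<^sub>M I (\<lambda>_. lborel))"
      "emeasure (Pi\<^sub>M I (\<lambda>_. lborel)) K' = emeasure (Pi\<^sub>M I (\<lambda>_. lborel)) K"
      "l2_diameter_le I K' D" "\<forall>j\<in>J. reflection_invariant j K'" by auto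
    show ?case
    proof (intro bexI[of _ "steiner I i K'"] conjI ballI)
      fix j assume "j \<in> insert i J"
      then show "reflection_invariant j (steiner I i K')"
        using insert.prems K' by (intro steiner_reflection_invariant) auto
    qed (use insert.prems K' I in \<open>auto simp: emeasure_steiner sets_steiner steiner_l2_diameter_le\<close>)
  qed
  from this[OF I order_refl] show thesis using that by blast
qed

lemma reflection_invariant_flip:
  assumes "finite J" "\<And>j. j \<in> J \<Longrightarrow> reflection_invariant j K" "x \<in> K"
  shows "(\<lambda>j. if j \<in> J then - x j else x j) \<in> K"
  using assms
proof (induction J rule: finite_induct)
  case (insert i J)
  let ?y = "\<lambda>j. if j \<in> J then - x j else x j"
  have "?y \<in> K" using insert by blast
  then have "?y(i := - ?y i) \<in> K"
    using insert.prems(1)[of i] unfolding reflection_invariant_def by blast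
  moreover have "?y(i := - ?y i) = (\<lambda>j. if j \<in> insert i J then - x j else x j)"
    using insert.hyps by auto
  ultimately show ?case by simp
qed auto

text \<open>
  A set invariant under all coordinate reflections contains \<open>- x\<close> with every \<open>x\<close>, and \<open>x\<close> and \<open>- x\<close> have
  distance at most \<open>D\<close>. So the symmetrised set lies in the ball of radius \<open>D / 2\<close> around the origin.
\<close>

theorem isodiametric_inequality:
  assumes K: "K \<in> sets (Pi\<^sub>M I (\<lambda>_. lborel))" and I: "finite I"
    and D: "l2_diameter_le I K D" "D \<ge> 0"
  shows "emeasure (Pi\<^sub>M I (\<lambda>_. lborel)) K \<le> ennreal (unit_ball_vol (real (card I)) * (D / 2) ^ card I)"
proof -
  obtain K' where K': "K' \<in> sets (Pi\<^sub>M I (\<lambda>_. lborel))"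
    "emeasure (Pi\<^sub>M I (\<lambda>_. lborel)) K' = emeasure (Pi\<^sub>M I (\<lambda>_. lborel)) K"
    "l2_diameter_le I K' D" "\<And>j. j \<in> I \<Longrightarrow> reflection_invariant j K'"
    by (rule symmetric_rearrangement_exists[OF K I D(1)]) blast
  have radius: "sqrt (\<Sum>j\<in>I. (x j)\<^sup>2) \<le> D / 2" if x: "x \<in> K'" for x
  proof -
    define y where "y = (\<lambda>j. if j \<in> I then - x j else x j)"
    have "y \<in> K'" using reflection_invariant_flip[OF I K'(4) x] by (simp add: y_def)
    then have "(\<Sum>j\<in>I. (x j - y j)\<^sup>2) \<le> D\<^sup>2" using K'(3) x by (auto simp: l2_diameter_le_def)
    also have "(\<Sum>j\<in>I. (x j - y j)\<^sup>2) = 4 * (\<Sum>j\<in>I. (x j)\<^sup>2)"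
      by (simp add: y_def sum_distrib_left power2_eq_square algebra_simps)
    finally have "(\<Sum>j\<in>I. (x j)\<^sup>2) \<le> (D / 2)\<^sup>2" by (simp add: power2_eq_square)
    then show ?thesis using D(2) by (intro real_le_lsqrt) auto
  qed
  \<comment> \<open>Radii \<open>r > D / 2\<close> are positive even when \<open>D = 0\<close>; the radius \<open>D / 2\<close> is reached as a limit.\<close>
  have le: "emeasure (Pi\<^sub>M I (\<lambda>_. lborel)) K \<le> ennreal (unit_ball_vol (real (card I)) * r ^ card I)"
    if "r > D / 2" for r
  proof -
    have "r > 0" using that D(2) by linarith
    have "K' \<subseteq> {f. sqrt (\<Sum>i\<in>I. (f i)\<^sup>2) \<le> r} \<inter> space (Pi\<^sub>M I (\<lambda>_. lborel))"
      using radius that sets.sets_into_space[OF K'(1)] by fastforce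
    then have "emeasure (Pi\<^sub>M I (\<lambda>_. lborel)) K' \<le>
       emeasure (Pi\<^sub>M I (\<lambda>_. lborel)) ({f. sqrt (\<Sum>i\<in>I. (f i)\<^sup>2) \<le> r} \<inter> space (Pi\<^sub>M I (\<lambda>_. lborel)))"
      by (intro emeasure_mono) (use I in measurable)
    then show ?thesis using emeasure_cball_aux[OF I \<open>r > 0\<close>] K'(2) by simp
  qed
  have "((\<lambda>r. ennreal (unit_ball_vol (real (card I)) * r ^ card I)) \<longlongrightarrow>
        ennreal (unit_ball_vol (real (card I)) * (D / 2) ^ card I)) (at_right (D / 2))"
    by (intro tendsto_intros)
  moreover have "\<forall>\<^sub>F r in at_right (D / 2).
      emeasure (Pi\<^sub>M I (\<lambda>_. lborel)) K \<le> ennreal (unit_ball_vol (real (card I)) * r ^ card I)"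
    by (rule eventually_mono[OF eventually_at_right_less le])
  ultimately show ?thesis
    by (rule tendsto_lowerbound) simp
qed

text \<open>
  Fubini's theorem splits off the coordinate along \<open>e\<close>; what is left is the volume of the base in the
  \<open>d - 1\<close> remaining coordinates, where the isodiametric inequality applies.
\<close>

lemma emeasure_cylinder_le:
  fixes e :: "'a::euclidean_space"
  assumes e: "e \<in> Basis" and Q: "closed Q" "bounded Q" "diameter Q \<le> D" "0 \<le> D"
    and "m \<le> M"
  shows "emeasure lborel {x. x \<bullet> e \<in> {m..M} \<and> x - (x \<bullet> e) *\<^sub>R e \<in> Q} \<le>
    ennreal (M - m) * ennreal (unit_ball_vol (real (DIM('a) - 1)) * (D / 2) ^ (DIM('a) - 1))"
proof -
  interpret product_sigma_finite "\<lambda>_. lborel :: real measure" by standard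
  define J where "J = (Basis :: 'a set) - {e}"
  have J: "finite J" "e \<notin> J" and BJ: "(Basis :: 'a set) = insert e J" using e by (auto simp: J_def)
  have cJ: "card J = DIM('a) - 1" using e by (simp add: J_def)
  define p where "p y = (\<Sum>b\<in>J. y b *\<^sub>R b)" for y :: "'a \<Rightarrow> real"
  have p_upd: "p (y(e := s)) = p y" for y s
    unfolding p_def using J by (intro sum.cong) auto
  have p_e: "p y \<bullet> e = 0" for y
    unfolding p_def inner_sum_left using e by (intro sum.neutral) (auto simp: J_def inner_Basis)
  have p_J: "p y \<bullet> b = y b" if "b \<in> J" for y b
  proof -
    have "p y \<bullet> b = (\<Sum>c\<in>J. if c = b then y c else 0)"
      unfolding p_def inner_sum_left using that by (intro sum.cong) (auto simp: J_def inner_Basis)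
    then show ?thesis using that J by simp
  qed
  have p_dist: "(dist (p y) (p z))\<^sup>2 = (\<Sum>b\<in>J. (y b - z b)\<^sup>2)" for y z
  proof -
    have "(dist (p y) (p z))\<^sup>2 = (\<Sum>b\<in>Basis. ((p y - p z) \<bullet> b) * ((p y - p z) \<bullet> b))"
      unfolding dist_norm power2_norm_eq_inner by (rule euclidean_inner)
    also have "\<dots> = (\<Sum>b\<in>J. (y b - z b)\<^sup>2)"
      using J by (simp add: BJ inner_diff_left p_e p_J power2_eq_square)
    finally show ?thesis .
  qed
  have p_meas [measurable]: "p \<in> borel_measurable (Pi\<^sub>M J (\<lambda>_. lborel))"
    unfolding p_def by measurable
  define K where "K = {y \<in> space (Pi\<^sub>M J (\<lambda>_. lborel)). p y \<in> Q}"
  have [measurable]: "Q \<in> sets borel" using Q(1) by (rule borel_closed)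
  have K: "K \<in> sets (Pi\<^sub>M J (\<lambda>_. lborel))" unfolding K_def by measurable
  have "l2_diameter_le J K D"
    unfolding l2_diameter_le_def
  proof (intro ballI)
    fix y z assume "y \<in> K" "z \<in> K"
    then have "dist (p y) (p z) \<le> D"
      using diameter_bounded_bound[OF Q(2), of "p y" "p z"] Q(3) by (auto simp: K_def)
    then show "(\<Sum>b\<in>J. (y b - z b)\<^sup>2) \<le> D\<^sup>2" unfolding p_dist[symmetric] by (simp add: power_mono)
  qed
  then have vK: "emeasure (Pi\<^sub>M J (\<lambda>_. lborel)) K \<le> ennreal (unit_ball_vol (real (card J)) * (D / 2) ^ card J)"
    using Q(4) by (rule isodiametric_inequality[OF K J(1)])
  define S where "S = {x. x \<bullet> e \<in> {m..M} \<and> x - (x \<bullet> e) *\<^sub>R e \<in> Q}"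
  have S [measurable]: "S \<in> sets borel" unfolding S_def by measurable
  let ?v = "\<lambda>f :: 'a \<Rightarrow> real. \<Sum>b\<in>Basis. f b *\<^sub>R b"
  have v: "?v (y(e := s)) = s *\<^sub>R e + p y" for y s
    using J p_upd[of y s] by (simp add: BJ p_def)
  have ind: "indicator S (?v (y(e := s))) = (indicator {m..M} s * indicator K y :: ennreal)"
    if "y \<in> space (Pi\<^sub>M J (\<lambda>_. lborel))" for y s
    using that e unfolding v by (auto simp: S_def K_def indicator_def inner_add_left p_e)
  have v_meas [measurable]: "?v \<in> borel_measurable (Pi\<^sub>M Basis (\<lambda>_. lborel))" by measurable
  have "emeasure lborel S = (\<integral>\<^sup>+f. indicator S (?v f) \<partial>Pi\<^sub>M Basis (\<lambda>_. lborel))"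
    unfolding nn_integral_indicator[OF S[folded sets_lborel], symmetric]
    by (subst lborel_eq, subst nn_integral_distr) simp_all
  also have "\<dots> = (\<integral>\<^sup>+y. \<integral>\<^sup>+s. indicator S (?v (y(e := s))) \<partial>lborel \<partial>Pi\<^sub>M J (\<lambda>_. lborel))"
    using v_meas unfolding BJ by (intro product_nn_integral_insert J) measurable
  also have "\<dots> = (\<integral>\<^sup>+y. \<integral>\<^sup>+s. indicator {m..M} s * indicator K y \<partial>lborel \<partial>Pi\<^sub>M J (\<lambda>_. lborel))"
    by (intro nn_integral_cong ind)
  also have "\<dots> = ennreal (M - m) * emeasure (Pi\<^sub>M J (\<lambda>_. lborel)) K"
    using \<open>m \<le> M\<close> K by (simp add: nn_integral_multc nn_integral_cmult)
  finally show ?thesis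
    using vK unfolding cJ S_def by (simp add: mult_left_mono)
qed

section \<open>Hausdorff measure\<close>

lemma hausdorff_measure_mono:
  assumes "A \<subseteq> B"
  shows "hausdorff_measure k A \<le> hausdorff_measure k B"
  unfolding hausdorff_measure_eq_SUP
proof (rule SUP_mono')
  show "hausdorff_pre k \<delta> A \<le> hausdorff_pre k \<delta> B" for \<delta>
    unfolding hausdorff_pre_def
    by (rule mult_left_mono, rule INF_superset_mono) (use assms in \<open>blast, simp_all\<close>)
qed

text \<open>
  To bound a quantity by a multiple of the premeasure it suffices to bound it for each cover. The factor
  is moved across the infimum by division, which is why it has to be positive and finite.
\<close>

lemma le_mult_hausdorff_preI:
  assumes "0 < c" and le: "\<And>B. (\<And>j. bounded (B j) \<and> diameter (B j) \<le> \<delta>) \<Longrightarrow> A \<subseteq> (\<Union>j. B j) \<Longrightarrow>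
    x \<le> ennreal c * (ennreal (unit_ball_vol (real k) / 2 ^ k) * (\<Sum>j. diam_pow k (B j)))"
  shows "x \<le> ennreal c * hausdorff_pre k \<delta> A"
proof -
  define q where "q = c * (unit_ball_vol (real k) / 2 ^ k)"
  have "0 < q" using \<open>0 < c\<close> by (simp add: q_def)
  have q: "ennreal c * (ennreal (unit_ball_vol (real k) / 2 ^ k) * y) = ennreal q * y" for y
    using \<open>0 < c\<close> unfolding q_def by (subst ennreal_mult) (simp_all add: mult.assoc)
  have "x / ennreal q \<le> (INF B \<in> {B. (\<forall>j. bounded (B j) \<and> diameter (B j) \<le> \<delta>) \<and> A \<subseteq> (\<Union>j. B j)}.
      \<Sum>j. diam_pow k (B j))" (is "_ \<le> ?I")
  proof (rule INF_greatest, rule divide_le_posI_ennreal)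
    fix B :: "nat \<Rightarrow> _" assume "B \<in> {B. (\<forall>j. bounded (B j) \<and> diameter (B j) \<le> \<delta>) \<and> A \<subseteq> (\<Union>j. B j)}"
    then show "x \<le> ennreal q * (\<Sum>j. diam_pow k (B j))" using le[of B] by (simp only: q) simp
  qed (use \<open>0 < q\<close> in simp)
  then have "ennreal q * (x / ennreal q) \<le> ennreal q * ?I" by (rule mult_left_mono) simp
  moreover have "ennreal q * (x / ennreal q) = x"
    using \<open>0 < q\<close> by (simp add: ennreal_times_divide mult.commute[of _ x] mult_divide_eq_ennreal)
  ultimately show ?thesis unfolding hausdorff_pre_def q by simp
qed

text \<open>
  Isometries transport covers without changing diameters.
\<close>

lemma hausdorff_measure_isometric_image:
  assumes f: "\<And>x y. dist (f x) (f y) = dist x y"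
  shows "hausdorff_measure k (f ` A) \<le> hausdorff_measure k A"
  unfolding hausdorff_measure_eq_SUP hausdorff_pre_def
proof (intro SUP_mono' mult_left_mono INF_mono)
  have diam: "bounded (f ` X) \<and> diameter (f ` X) = diameter X" if X: "bounded X" for X
  proof
    obtain x r where "\<forall>y\<in>X. dist x y \<le> r" using X unfolding bounded_def by blast
    then have "\<forall>z\<in>f ` X. dist (f x) z \<le> r" by (simp add: f)
    then show "bounded (f ` X)" unfolding bounded_def by blast
    have "(case (f x, f y) of (u, v) \<Rightarrow> dist u v) = (case (x, y) of (u, v) \<Rightarrow> dist u v)" for x y by (simp add: f)
    moreover have "f ` X \<times> f ` X = (\<lambda>(x, y). (f x, f y)) ` (X \<times> X)" by auto
    ultimately show "diameter (f ` X) = diameter X"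
      unfolding diameter_def by (simp add: image_image case_prod_unfold)
  qed
  fix \<delta> and B :: "nat \<Rightarrow> _"
  assume "B \<in> {B. (\<forall>j. bounded (B j) \<and> diameter (B j) \<le> \<delta>) \<and> A \<subseteq> (\<Union>j. B j)}"
  then have B: "\<And>j. bounded (B j)" "\<And>j. diameter (B j) \<le> \<delta>" "A \<subseteq> (\<Union>j. B j)" by auto
  show "\<exists>C\<in>{C. (\<forall>j. bounded (C j) \<and> diameter (C j) \<le> \<delta>) \<and> f ` A \<subseteq> (\<Union>j. C j)}.
      (\<Sum>j. diam_pow k (C j)) \<le> (\<Sum>j. diam_pow k (B j))"
  proof (intro bexI[of _ "\<lambda>j. f ` B j"] CollectI conjI allI)
    show "f ` A \<subseteq> (\<Union>j. f ` B j)" using B(3) by blast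
    have "diam_pow k (f ` B j) = diam_pow k (B j)" for j
      using B(1) diam by (simp add: diam_pow_def)
    then show "(\<Sum>j. diam_pow k (f ` B j)) \<le> (\<Sum>j. diam_pow k (B j))" by simp
  qed (use B diam in simp_all)
qed simp

section \<open>Hausdorff measure is at most Lebesgue measure\<close>

text \<open>
  Covers that arise from covering theorems are indexed by countable, possibly finite sets. Padding with
  the empty set, for which \<open>diam_pow\<close> vanishes even when \<open>k = 0\<close>, turns them into sequences.
\<close>

lemma hausdorff_pre_le_countable_cover:
  fixes B :: "'i \<Rightarrow> 'a::metric_space set"
  assumes I: "countable I" and "\<delta> \<ge> 0"
    and B: "\<And>i. i \<in> I \<Longrightarrow> bounded (B i)" "\<And>i. i \<in> I \<Longrightarrow> diameter (B i) \<le> \<delta>" "A \<subseteq> (\<Union>i\<in>I. B i)"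
  shows "hausdorff_pre k \<delta> A \<le>
    ennreal (unit_ball_vol (real k) / 2 ^ k) * (\<integral>\<^sup>+i. diam_pow k (B i) \<partial>count_space I)"
proof -
  define N where "N = to_nat_on I ` I"
  define C where "C n = (if n \<in> N then B (from_nat_into I n) else {})" for n
  have bij: "bij_betw (from_nat_into I) N I"
    unfolding bij_betw_def N_def using I by (auto simp: inj_on_def image_image)
  then have mem: "from_nat_into I n \<in> I" if "n \<in> N" for n using that by (auto simp: bij_betw_def)
  have "A \<subseteq> (\<Union>n. C n)"
  proof
    fix x assume "x \<in> A"
    then obtain i where "i \<in> I" "x \<in> B i" using B(3) by auto
    then have "x \<in> C (to_nat_on I i)" using I by (auto simp: C_def N_def)
    then show "x \<in> (\<Union>n. C n)" by blast
  qed
  moreover have "bounded (C n) \<and> diameter (C n) \<le> \<delta>" for n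
    using B(1,2) mem \<open>\<delta> \<ge> 0\<close> by (auto simp: C_def)
  ultimately have "hausdorff_pre k \<delta> A \<le> ennreal (unit_ball_vol (real k) / 2 ^ k) * (\<Sum>n. diam_pow k (C n))"
    unfolding hausdorff_pre_def by (intro mult_left_mono INF_lower) auto
  also have "(\<Sum>n. diam_pow k (C n)) = (\<integral>\<^sup>+n. diam_pow k (C n) \<partial>count_space UNIV)"
    by (rule nn_integral_count_space_nat[symmetric])
  also have "\<dots> = (\<integral>\<^sup>+n. diam_pow k (B (from_nat_into I n)) * indicator N n \<partial>count_space UNIV)"
    by (intro nn_integral_cong) (auto simp: C_def diam_pow_def)
  also have "\<dots> = (\<integral>\<^sup>+n. diam_pow k (B (from_nat_into I n)) \<partial>count_space N)"
    by (simp add: nn_integral_count_space_indicator)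
  also have "\<dots> = (\<integral>\<^sup>+i. diam_pow k (B i) \<partial>count_space I)"
    by (rule nn_integral_bij_count_space[OF bij])
  finally show ?thesis .
qed

lemma hausdorff_pre_le_two_covers:
  fixes B :: "'i \<Rightarrow> 'a::metric_space set" and C :: "'j \<Rightarrow> 'a set"
  assumes I: "countable I" and J: "countable J" and \<delta>: "\<delta> \<ge> 0"
    and B: "\<And>i. i \<in> I \<Longrightarrow> bounded (B i)" "\<And>i. i \<in> I \<Longrightarrow> diameter (B i) \<le> \<delta>"
    and C: "\<And>j. j \<in> J \<Longrightarrow> bounded (C j)" "\<And>j. j \<in> J \<Longrightarrow> diameter (C j) \<le> \<delta>"
    and A: "A \<subseteq> (\<Union>i\<in>I. B i) \<union> (\<Union>j\<in>J. C j)"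
  shows "hausdorff_pre k \<delta> A \<le> ennreal (unit_ball_vol (real k) / 2 ^ k) *
    ((\<integral>\<^sup>+i. diam_pow k (B i) \<partial>count_space I) + (\<integral>\<^sup>+j. diam_pow k (C j) \<partial>count_space J))"
proof -
  let ?f = "\<lambda>x. diam_pow k (case_sum B C x)"
  have "hausdorff_pre k \<delta> A \<le>
    ennreal (unit_ball_vol (real k) / 2 ^ k) * (\<integral>\<^sup>+x. ?f x \<partial>count_space (I <+> J))"
    by (rule hausdorff_pre_le_countable_cover) (use assms in \<open>auto simp: Plus_def\<close>)
  also have "(\<integral>\<^sup>+x. ?f x \<partial>count_space (I <+> J)) =
      (\<integral>\<^sup>+x. ?f x * indicator (Inl ` I) x + ?f x * indicator (Inr ` J) x \<partial>count_space UNIV)"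
    unfolding Plus_def by (subst nn_integral_count_space_indicator)
      (auto simp: indicator_def intro!: nn_integral_cong)
  also have "\<dots> = (\<integral>\<^sup>+x. ?f x \<partial>count_space (Inl ` I)) + (\<integral>\<^sup>+x. ?f x \<partial>count_space (Inr ` J))"
    by (simp add: nn_integral_add nn_integral_count_space_indicator)
  also have "(\<integral>\<^sup>+x. ?f x \<partial>count_space (Inl ` I)) = (\<integral>\<^sup>+i. diam_pow k (B i) \<partial>count_space I)"
    using nn_integral_bij_count_space[of "Inl :: 'i \<Rightarrow> 'i + 'j" I "Inl ` I" ?f] by (simp add: bij_betw_def)
  also have "(\<integral>\<^sup>+x. ?f x \<partial>count_space (Inr ` J)) = (\<integral>\<^sup>+j. diam_pow k (C j) \<partial>count_space J)"
    using nn_integral_bij_count_space[of "Inr :: 'j \<Rightarrow> 'i + 'j" J "Inr ` J" ?f] by (simp add: bij_betw_def)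
  finally show ?thesis .
qed

text \<open>
  For balls, the normalised summand in the premeasure is the volume, so disjoint balls in \<open>U\<close> contribute at most
  the volume of \<open>U\<close>. The factor \<open>c\<close> allows for the enlargement of the balls in the covering lemma.
\<close>

lemma disjoint_balls_diam_pow_le:
  fixes a :: "'i \<Rightarrow> 'a::euclidean_space"
  assumes C: "countable C" and r: "\<And>i. i \<in> C \<Longrightarrow> 0 < r i" and c: "0 < c"
    and disj: "pairwise (\<lambda>i j. disjnt (ball (a i) (r i)) (ball (a j) (r j))) C"
    and U: "open U" "\<And>i. i \<in> C \<Longrightarrow> ball (a i) (r i) \<subseteq> U"
  shows "ennreal (unit_ball_vol (real DIM('a)) / 2 ^ DIM('a)) *
      (\<integral>\<^sup>+i. diam_pow DIM('a) (ball (a i) (c * r i)) \<partial>count_space C)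
    \<le> ennreal (c ^ DIM('a)) * emeasure lborel U"
proof -
  let ?d = "DIM('a)"
  have one: "ennreal (unit_ball_vol (real ?d) / 2 ^ ?d) * diam_pow ?d (ball (a i) (c * r i)) =
      ennreal (c ^ ?d) * emeasure lborel (ball (a i) (r i))" if "i \<in> C" for i
  proof -
    have "0 < r i" "0 < c * r i" using r[OF that] c by auto
    then have "\<not> c * r i \<le> 0" "\<not> c * r i < 0" "0 \<le> r i" by auto
    then show ?thesis using c
      by (simp add: diam_pow_def emeasure_ball ennreal_mult'[symmetric] power_mult_distrib mult_ac)
  qed
  have "ennreal (unit_ball_vol (real ?d) / 2 ^ ?d) *
      (\<integral>\<^sup>+i. diam_pow ?d (ball (a i) (c * r i)) \<partial>count_space C) =
      (\<integral>\<^sup>+i. ennreal (c ^ ?d) * emeasure lborel (ball (a i) (r i)) \<partial>count_space C)"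
    by (subst nn_integral_cmult[symmetric]) (auto simp: one intro!: nn_integral_cong)
  also have "\<dots> = ennreal (c ^ ?d) * (\<integral>\<^sup>+i. emeasure lborel (ball (a i) (r i)) \<partial>count_space C)"
    by (rule nn_integral_cmult) auto
  also have "(\<integral>\<^sup>+i. emeasure lborel (ball (a i) (r i)) \<partial>count_space C) = emeasure lborel (\<Union>i\<in>C. ball (a i) (r i))"
    using disj by (intro emeasure_UN_countable[symmetric] C)
      (auto simp: disjoint_family_on_def pairwise_def disjnt_def)
  also have "\<dots> \<le> emeasure lborel U"
    using U by (intro emeasure_mono) auto
  finally show ?thesis by (simp add: mult_left_mono)
qed

text \<open>
  Inside an open set of small volume around \<open>N\<close>, the covering lemma selects disjoint balls whose fivefold
  enlargements cover \<open>N\<close>; this costs only the factor \<open>5 ^ d\<close>.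
\<close>

lemma null_set_ball_cover:
  fixes N :: "'a::euclidean_space set"
  assumes N: "N \<in> null_sets lborel" and \<delta>: "\<delta> > 0" and \<epsilon>: "\<epsilon> > 0"
  obtains C :: "('a \<times> real) set" where "countable C" "N \<subseteq> (\<Union>(x, r)\<in>C. ball x (5 * r))"
    "\<And>x r. (x, r) \<in> C \<Longrightarrow> 0 < r \<and> 10 * r \<le> \<delta>"
    "ennreal (unit_ball_vol (real DIM('a)) / 2 ^ DIM('a)) *
      (\<integral>\<^sup>+i. diam_pow DIM('a) (ball (fst i) (5 * snd i)) \<partial>count_space C) \<le> ennreal \<epsilon>"
proof -
  let ?d = "DIM('a)"
  obtain V where V: "open V" "N \<subseteq> V" "emeasure lborel (V - N) < ennreal (\<epsilon> / 5 ^ ?d)"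
    using outer_regular_lborel[of N "\<epsilon> / 5 ^ ?d"] null_setsD2[OF N] \<epsilon>
    by (metis divide_pos_pos sets_lborel zero_less_numeral zero_less_power)
  have "emeasure lborel V \<le> ennreal (\<epsilon> / 5 ^ ?d)"
    using emeasure_Diff_null_set[OF N, of V] V by auto
  then have "ennreal (5 ^ ?d) * emeasure lborel V \<le> ennreal (5 ^ ?d) * ennreal (\<epsilon> / 5 ^ ?d)"
    by (rule mult_left_mono) simp
  then have Vle: "ennreal (5 ^ ?d) * emeasure lborel V \<le> ennreal \<epsilon>"
    using \<epsilon> by (simp add: ennreal_mult[symmetric])
  define K where "K = {(x, r). 0 < r \<and> 10 * r \<le> \<delta> \<and> ball x r \<subseteq> V}"
  have cover: "N \<subseteq> (\<Union>i\<in>K. ball (fst i) (snd i))"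
  proof
    fix x assume "x \<in> N"
    then obtain r where "r > 0" "ball x r \<subseteq> V" using V(1,2) by (meson openE subsetD)
    then have "(x, min r (\<delta> / 10)) \<in> K" using \<delta> by (auto simp: K_def)
    moreover have "x \<in> ball x (min r (\<delta> / 10))" using \<open>r > 0\<close> \<delta> by simp
    ultimately show "x \<in> (\<Union>i\<in>K. ball (fst i) (snd i))" by force
  qed
  have rK: "0 < snd i \<and> snd i \<le> \<delta>" if "i \<in> K" for i
    using that \<delta> by (simp add: K_def case_prod_unfold)
  obtain C where C: "countable C" "C \<subseteq> K"
     "pairwise (\<lambda>i j. disjnt (ball (fst i) (snd i)) (ball (fst j) (snd j))) C"
     "N \<subseteq> (\<Union>i\<in>C. ball (fst i) (5 * snd i))"
    by (rule Vitali_covering_lemma_balls[OF cover rK])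
  have C_K: "0 < snd i" "10 * snd i \<le> \<delta>" "ball (fst i) (snd i) \<subseteq> V" if "i \<in> C" for i
    using subsetD[OF C(2) that] by (simp_all add: K_def case_prod_unfold)
  show thesis
  proof
    show "N \<subseteq> (\<Union>(x, r)\<in>C. ball x (5 * r))" using C(4) by (simp add: case_prod_unfold)
    show "ennreal (unit_ball_vol (real ?d) / 2 ^ ?d) *
      (\<integral>\<^sup>+i. diam_pow ?d (ball (fst i) (5 * snd i)) \<partial>count_space C) \<le> ennreal \<epsilon>"
      by (rule order_trans[OF disjoint_balls_diam_pow_le[OF C(1) C_K(1) _ C(3) V(1) C_K(3)] Vle]) simp_all
    show "0 < r \<and> 10 * r \<le> \<delta>" if "(x, r) \<in> C" for x r using C_K[OF that] by simp
  qed (use C(1) in simp)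
qed

text \<open>
  Vitali's theorem fills an open set that is only slightly larger than \<open>E\<close> with small disjoint balls,
  up to a null set. The balls contribute at most the volume of the open set, and the null set an
  arbitrarily small amount.
\<close>

theorem hausdorff_measure_le_lborel:
  fixes E :: "'a::euclidean_space set"
  assumes E: "E \<in> sets borel"
  shows "hausdorff_measure DIM('a) E \<le> emeasure lborel E"
  unfolding hausdorff_measure_eq_SUP
proof (rule SUP_least, rule ennreal_le_epsilon)
  let ?d = "DIM('a)"
  fix \<delta> \<epsilon> :: real assume "\<delta> \<in> {0<..}" and \<epsilon>: "\<epsilon> > 0"
  then have \<delta>: "\<delta> > 0" by simp
  obtain U where U: "open U" "E \<subseteq> U" "emeasure lborel (U - E) < ennreal (\<epsilon> / 2)"
    using outer_regular_lborel[OF E, of "\<epsilon> / 2"] \<epsilon> by auto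
  have "emeasure lborel U = emeasure lborel (E \<union> (U - E))" using U(2) by (simp add: Un_absorb1)
  also have "\<dots> \<le> emeasure lborel E + emeasure lborel (U - E)"
    using E U(1) by (intro emeasure_subadditive) auto
  also have "\<dots> \<le> emeasure lborel E + ennreal (\<epsilon> / 2)"
    using U(3) by (intro add_left_mono) simp
  finally have Ule: "emeasure lborel U \<le> emeasure lborel E + ennreal (\<epsilon> / 2)" .
  define K where "K = {(x, r). 0 < r \<and> 2 * r \<le> \<delta> \<and> ball x r \<subseteq> U}"
  have fine: "\<exists>i. i \<in> K \<and> x \<in> ball (fst i) (snd i) \<and> snd i < \<eta>" if "x \<in> U" "0 < \<eta>" for x \<eta>
  proof -
    obtain r where "r > 0" "ball x r \<subseteq> U" using U \<open>x \<in> U\<close> by (auto simp: open_contains_ball)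
    then have "(x, min r (min (\<delta> / 2) (\<eta> / 2))) \<in> K" using \<delta> \<open>\<eta> > 0\<close> by (auto simp: K_def)
    moreover have "x \<in> ball x (min r (min (\<delta> / 2) (\<eta> / 2)))" using \<open>r > 0\<close> \<delta> \<open>\<eta> > 0\<close> by simp
    ultimately show ?thesis using \<open>\<eta> > 0\<close> by force
  qed
  obtain C where C: "countable C" "C \<subseteq> K"
     "pairwise (\<lambda>i j. disjnt (ball (fst i) (snd i)) (ball (fst j) (snd j))) C"
     "negligible (U - (\<Union>i\<in>C. ball (fst i) (snd i)))"
    by (rule Vitali_covering_theorem_balls[of U K fst snd, OF fine])
  define N where "N = U - (\<Union>i\<in>C. ball (fst i) (snd i))"
  have "N \<in> sets borel" unfolding N_def by (intro sets.Diff borel_open U(1) open_UN ballI open_ball)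
  then have null: "N \<in> null_sets lborel"
    using C(4) by (simp add: N_def[symmetric] negligible_iff_null_sets null_sets_completion_iff)
  obtain C' :: "('a \<times> real) set" where C': "countable C'"
    "N \<subseteq> (\<Union>(x, r)\<in>C'. ball x (5 * r))"
    "\<And>x r. (x, r) \<in> C' \<Longrightarrow> 0 < r \<and> 10 * r \<le> \<delta>"
    "ennreal (unit_ball_vol (real ?d) / 2 ^ ?d) *
      (\<integral>\<^sup>+i. diam_pow ?d (ball (fst i) (5 * snd i)) \<partial>count_space C') \<le> ennreal (\<epsilon> / 2)"
    by (rule null_set_ball_cover[OF null \<delta> half_gt_zero[OF \<epsilon>]]) (rule that)
  have r: "0 < snd i" "2 * snd i \<le> \<delta>" "ball (fst i) (snd i) \<subseteq> U" if "i \<in> C" for i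
    using subsetD[OF C(2) that] by (simp_all add: K_def case_prod_unfold)
  have r': "0 < snd i" "10 * snd i \<le> \<delta>" if "i \<in> C'" for i
    using C'(3)[of "fst i" "snd i"] that by auto
  have "hausdorff_pre ?d \<delta> E \<le> ennreal (unit_ball_vol (real ?d) / 2 ^ ?d) *
    ((\<integral>\<^sup>+i. diam_pow ?d (ball (fst i) (1 * snd i)) \<partial>count_space C) +
     (\<integral>\<^sup>+i. diam_pow ?d (ball (fst i) (5 * snd i)) \<partial>count_space C'))"
  proof (rule hausdorff_pre_le_two_covers)
    have "E \<subseteq> (\<Union>i\<in>C. ball (fst i) (snd i)) \<union> N" using U(2) by (auto simp: N_def)
    then show "E \<subseteq> (\<Union>i\<in>C. ball (fst i) (1 * snd i)) \<union> (\<Union>i\<in>C'. ball (fst i) (5 * snd i))"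
      using C'(2) by (force simp: case_prod_unfold)
  next
    show "diameter (ball (fst i) (1 * snd i)) \<le> \<delta>" if "i \<in> C" for i using r[OF that] by simp
    show "diameter (ball (fst i) (5 * snd i)) \<le> \<delta>" if "i \<in> C'" for i using r'[OF that] by simp
  qed (use C(1) C'(1) \<delta> in simp_all)
  also have "\<dots> \<le> ennreal (1 ^ ?d) * emeasure lborel U + ennreal (\<epsilon> / 2)"
    unfolding distrib_left
    by (intro add_mono disjoint_balls_diam_pow_le C(1,3) C'(4) U(1) r) simp_all
  also have "\<dots> \<le> emeasure lborel E + ennreal (\<epsilon> / 2) + ennreal (\<epsilon> / 2)"
    using Ule by (simp add: add_right_mono)
  also have "\<dots> = emeasure lborel E + ennreal \<epsilon>"
    using \<epsilon> by (simp add: add.assoc ennreal_plus[symmetric] del: ennreal_plus)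
  finally show "hausdorff_pre ?d \<delta> E \<le> emeasure lborel E + ennreal \<epsilon>" .
qed

section \<open>Sets swept out by a translation\<close>

definition sweep :: "'a::real_vector set \<Rightarrow> 'a \<Rightarrow> 'a set" where
  "sweep B t = (\<Union>s\<in>{0..1}. (\<lambda>b. b + s *\<^sub>R t) ` B)"

lemma sweep_mono: "A \<subseteq> B \<Longrightarrow> sweep A t \<subseteq> sweep B t"
  unfolding sweep_def by (intro UN_mono image_mono) auto

lemma sweep_UN: "sweep (\<Union>j\<in>J. X j) t = (\<Union>j\<in>J. sweep (X j) t)"
  unfolding sweep_def unfolding image_UN by (rule SUP_commute)

text \<open>
  The measurable superset \<open>S\<close> is the cylinder along \<open>e\<close> over the closure of the projection of \<open>B\<close> to the
  hyperplane orthogonal to \<open>e\<close>. Its length exceeds \<open>\<tau>\<close> by at most the extent of \<open>B\<close> in the direction \<open>e\<close>.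
\<close>

lemma sweep_thin_set_volume:
  fixes e :: "'a::euclidean_space"
  assumes e: "e \<in> Basis" and \<tau>: "\<tau> > 0" and B: "bounded B" "diameter B \<le> \<delta>"
  obtains S where "S \<in> sets borel" "sweep B (\<tau> *\<^sub>R e) \<subseteq> S"
    "emeasure lborel S \<le> ennreal (\<tau> + \<delta>) *
       (ennreal (unit_ball_vol (real (DIM('a) - 1)) / 2 ^ (DIM('a) - 1)) * diam_pow (DIM('a) - 1) B)"
proof (cases "B = {}")
  case True
  show thesis by (rule that[of "{}"]) (use True in \<open>auto simp: sweep_def\<close>)
next
  case False
  define D where "D = diameter B"
  have D: "0 \<le> D" "D \<le> \<delta>" using B by (auto simp: D_def diameter_ge_0)
  have near: "norm (x - y) \<le> D" if "x \<in> B" "y \<in> B" for x y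
    using diameter_bounded_bound[OF B(1) that] by (simp add: D_def dist_norm)
  define h where "h = (\<lambda>x. x \<bullet> e) ` B"
  have e1: "norm e = 1" "e \<bullet> e = 1" using e by auto
  have "bounded h" unfolding h_def
    by (rule bounded_linear_image[OF B(1) bounded_linear_inner_left])
  then have bh: "bdd_below h" "bdd_above h" by (auto intro: bounded_imp_bdd_above bounded_imp_bdd_below)
  have h_ne: "h \<noteq> {}" using False by (simp add: h_def)
  have h_near: "u \<le> w + D" if uw: "u \<in> h" "w \<in> h" for u w
  proof -
    obtain x y where "x \<in> B" "y \<in> B" "u = x \<bullet> e" "w = y \<bullet> e" using uw by (auto simp: h_def)
    moreover have "(x - y) \<bullet> e \<le> norm (x - y)" using norm_cauchy_schwarz[of "x - y" e] e1 by simp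
    ultimately show ?thesis using near[of x y] by (simp add: inner_diff_left)
  qed
  have "Sup h \<le> Inf h + D"
  proof (rule cSup_least[OF h_ne])
    fix u assume "u \<in> h"
    then have "u - D \<le> Inf h" using h_near[of u] by (intro cInf_greatest[OF h_ne]) fastforce
    then show "u \<le> Inf h + D" by simp
  qed
  moreover have "Inf h \<le> Sup h" by (rule cInf_le_cSup[OF h_ne bh(2) bh(1)])
  ultimately have width: "Inf h \<le> Sup h + \<tau>" "Sup h + \<tau> - Inf h \<le> \<tau> + D" using \<tau> by auto
  define pr where "pr x = x - (x \<bullet> e) *\<^sub>R e" for x
  have pr_norm: "norm (pr v) \<le> norm v" for v
  proof -
    have "pr v \<bullet> pr v = v \<bullet> v - (v \<bullet> e)\<^sup>2"
      using e1 by (simp add: pr_def inner_diff inner_commute power2_eq_square algebra_simps)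
    then show ?thesis by (simp add: norm_le)
  qed
  have pr_near: "norm (pr x - pr y) \<le> D" if "x \<in> B" "y \<in> B" for x y
  proof -
    have "pr x - pr y = pr (x - y)" by (simp add: pr_def inner_diff_left algebra_simps)
    then show ?thesis using pr_norm[of "x - y"] near[OF that] by simp
  qed
  have bpr: "bounded (pr ` B)"
    using B(1) by (auto simp: bounded_iff intro: order_trans[OF pr_norm])
  define Q where "Q = closure (pr ` B)"
  have Q: "closed Q" "bounded Q" using bpr by (auto simp: Q_def bounded_closure)
  have "diameter Q \<le> D"
    unfolding Q_def diameter_closure[OF bpr]
    by (rule diameter_le) (use False pr_near in auto)
  define S where "S = {x. x \<bullet> e \<in> {Inf h..Sup h + \<tau>} \<and> x - (x \<bullet> e) *\<^sub>R e \<in> Q}"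
  have [measurable]: "Q \<in> sets borel" using Q(1) by (rule borel_closed)
  show thesis
  proof
    show "S \<in> sets borel" unfolding S_def by measurable
    show "sweep B (\<tau> *\<^sub>R e) \<subseteq> S"
    proof
      fix x assume "x \<in> sweep B (\<tau> *\<^sub>R e)"
      then obtain b s where b: "b \<in> B" and s: "0 \<le> s" "s \<le> 1" and x: "x = b + s *\<^sub>R (\<tau> *\<^sub>R e)"
        by (auto simp: sweep_def)
      have "b \<bullet> e \<in> h" using b by (simp add: h_def)
      then have "Inf h \<le> b \<bullet> e" "b \<bullet> e \<le> Sup h" using bh by (auto intro: cInf_lower cSup_upper)
      moreover have "0 \<le> s * \<tau>" "s * \<tau> \<le> \<tau>" using s \<tau> by (auto simp: mult_left_le_one_le)
      moreover have "x \<bullet> e = b \<bullet> e + s * \<tau>" using e1 by (simp add: x inner_add_left)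
      moreover have "x - (x \<bullet> e) *\<^sub>R e = pr b"
        using e1 by (simp add: x pr_def inner_add_left scaleR_add_left)
      moreover have "pr b \<in> Q" using b closure_subset[of "pr ` B"] by (auto simp: Q_def)
      ultimately show "x \<in> S" by (simp add: S_def)
    qed
    have "emeasure lborel S \<le> ennreal (Sup h + \<tau> - Inf h) *
        ennreal (unit_ball_vol (real (DIM('a) - 1)) * (D / 2) ^ (DIM('a) - 1))"
      unfolding S_def by (rule emeasure_cylinder_le) fact+
    also have "\<dots> \<le> ennreal (\<tau> + \<delta>) *
        ennreal (unit_ball_vol (real (DIM('a) - 1)) * (D / 2) ^ (DIM('a) - 1))"
      using width D by (intro mult_right_mono ennreal_leI) auto
    also have "ennreal (unit_ball_vol (real (DIM('a) - 1)) * (D / 2) ^ (DIM('a) - 1)) =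
       ennreal (unit_ball_vol (real (DIM('a) - 1)) / 2 ^ (DIM('a) - 1)) * diam_pow (DIM('a) - 1) B"
      using False D by (simp add: diam_pow_def D_def[symmetric] ennreal_mult[symmetric] power_divide)
    finally show "emeasure lborel S \<le> ennreal (\<tau> + \<delta>) *
       (ennreal (unit_ball_vol (real (DIM('a) - 1)) / 2 ^ (DIM('a) - 1)) * diam_pow (DIM('a) - 1) B)" .
  qed
qed

lemma hausdorff_measure_sweep_axis:
  fixes e :: "'a::euclidean_space"
  assumes e: "e \<in> Basis" and \<tau>: "\<tau> > 0"
  shows "hausdorff_measure DIM('a) (sweep B (\<tau> *\<^sub>R e)) \<le> ennreal \<tau> * hausdorff_measure (DIM('a) - 1) B"
proof -
  let ?k = "DIM('a) - 1"
  let ?w = "ennreal (unit_ball_vol (real ?k) / 2 ^ ?k)"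
  let ?h = "hausdorff_measure DIM('a) (sweep B (\<tau> *\<^sub>R e))"
  have le: "?h \<le> ennreal (\<tau> + \<delta>) * hausdorff_measure ?k B" if "\<delta> > 0" for \<delta>
  proof -
    have "?h \<le> ennreal (\<tau> + \<delta>) * hausdorff_pre ?k \<delta> B"
    proof (rule le_mult_hausdorff_preI)
      fix X :: "nat \<Rightarrow> 'a set"
      assume X: "\<And>j. bounded (X j) \<and> diameter (X j) \<le> \<delta>" "B \<subseteq> (\<Union>j. X j)"
      have "\<exists>S. S \<in> sets borel \<and> sweep (X j) (\<tau> *\<^sub>R e) \<subseteq> S \<and>
          emeasure lborel S \<le> ennreal (\<tau> + \<delta>) * (?w * diam_pow ?k (X j))" for j
      proof (rule sweep_thin_set_volume[OF e \<tau>, of "X j" \<delta>])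
        show "bounded (X j)" "diameter (X j) \<le> \<delta>" using X(1) by auto
      qed (intro exI conjI)
      from choice[OF allI[OF this]] obtain S where "\<forall>j. S j \<in> sets borel \<and> sweep (X j) (\<tau> *\<^sub>R e) \<subseteq> S j \<and>
          emeasure lborel (S j) \<le> ennreal (\<tau> + \<delta>) * (?w * diam_pow ?k (X j))"
        by (rule exE)
      then have S: "\<And>j. S j \<in> sets borel" "\<And>j. sweep (X j) (\<tau> *\<^sub>R e) \<subseteq> S j"
          "\<And>j. emeasure lborel (S j) \<le> ennreal (\<tau> + \<delta>) * (?w * diam_pow ?k (X j))"
        by auto
      have "sweep B (\<tau> *\<^sub>R e) \<subseteq> (\<Union>j. S j)"
        using sweep_mono[OF X(2), of "\<tau> *\<^sub>R e"] UN_mono[OF order_refl S(2)] unfolding sweep_UN by (rule order_trans)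
      then have "?h \<le> hausdorff_measure DIM('a) (\<Union>j. S j)" by (rule hausdorff_measure_mono)
      also have "\<dots> \<le> emeasure lborel (\<Union>j. S j)"
        using S(1) by (intro hausdorff_measure_le_lborel) auto
      also have "\<dots> \<le> (\<Sum>j. emeasure lborel (S j))"
        using S(1) by (intro emeasure_subadditive_countably) auto
      also have "\<dots> \<le> (\<Sum>j. ennreal (\<tau> + \<delta>) * (?w * diam_pow ?k (X j)))"
        by (intro suminf_le S(3)) auto
      also have "\<dots> = ennreal (\<tau> + \<delta>) * (?w * (\<Sum>j. diam_pow ?k (X j)))" by simp
      finally show "?h \<le> ennreal (\<tau> + \<delta>) * (?w * (\<Sum>j. diam_pow ?k (X j)))" .
    qed (use \<tau> that in simp)
    also have "\<dots> \<le> ennreal (\<tau> + \<delta>) * hausdorff_measure ?k B"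
      unfolding hausdorff_measure_eq_SUP using that by (intro mult_left_mono SUP_upper) simp_all
    finally show ?thesis .
  qed
  show ?thesis
  proof (cases "hausdorff_measure ?k B = top")
    case True
    then show ?thesis using \<tau> by (simp add: ennreal_mult_top)
  next
    case False
    have "((\<lambda>\<delta>. ennreal (\<tau> + \<delta>) * hausdorff_measure ?k B) \<longlongrightarrow> ennreal (\<tau> + 0) * hausdorff_measure ?k B) (at_right 0)"
      using \<tau> by (intro tendsto_mult_ennreal tendsto_ennrealI tendsto_intros) auto
    moreover have "\<forall>\<^sub>F \<delta> in at_right 0. ?h \<le> ennreal (\<tau> + \<delta>) * hausdorff_measure ?k B"
      by (rule eventually_mono[OF eventually_at_right_less le])
    ultimately have "?h \<le> ennreal (\<tau> + 0) * hausdorff_measure ?k B"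
      by (rule tendsto_lowerbound) simp
    then show ?thesis by simp
  qed
qed

text \<open>
  The map is the reflection in the hyperplane that bisects \<open>t\<close> and \<open>norm t *\<^sub>R e\<close>. If the two vectors
  coincide then \<open>v = 0\<close>, and the formula gives the identity.
\<close>

lemma reflection_onto_axis:
  fixes t e :: "'a::real_inner"
  assumes "norm e = 1"
  obtains f :: "'a \<Rightarrow> 'a" where "linear f" "\<And>x. f (f x) = x" "\<And>x y. dist (f x) (f y) = dist x y"
    "f t = norm t *\<^sub>R e"
proof -
  define v where "v = t - norm t *\<^sub>R e"
  define f where "f x = x - (2 * (x \<bullet> v) / (v \<bullet> v)) *\<^sub>R v" for x
  have lin: "linear f"
    by (rule linearI) (simp_all add: f_def inner_add_left algebra_simps add_divide_distrib)
  have fv: "f x \<bullet> v = - (x \<bullet> v)" for x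
    by (cases "v = 0") (simp_all add: f_def inner_diff_left)
  have inv: "f (f x) = x" for x
    unfolding f_def[of "f x"] fv by (simp add: f_def)
  have norm: "norm (f x) = norm x" for x
  proof -
    have "f x \<bullet> f x = x \<bullet> x"
      by (cases "v = 0") (simp_all add: f_def inner_diff inner_commute field_simps)
    then show ?thesis by (simp add: norm_eq)
  qed
  have ee: "e \<bullet> e = 1" using assms by (simp add: norm_eq_1)
  have tt: "t \<bullet> t = norm t * norm t" by (simp add: dot_square_norm power2_eq_square)
  have "v \<bullet> v = 2 * (t \<bullet> v)"
    by (simp add: v_def inner_diff_left inner_diff_right inner_commute[of e t] ee tt algebra_simps)
  then have "f t = t - v"
    by (cases "v = 0") (simp_all only: f_def inner_eq_zero_iff divide_self scaleR_one inner_zero_right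
        scaleR_zero_right refl not_False_eq_True flip: \<open>v \<bullet> v = 2 * (t \<bullet> v)\<close>)
  then have "f t = norm t *\<^sub>R e" by (simp add: v_def)
  moreover have "dist (f x) (f y) = dist x y" for x y
    using norm[of "x - y"] by (simp add: dist_norm linear_diff[OF lin])
  ultimately show thesis using that lin inv by blast
qed

theorem hausdorff_measure_sweep:
  fixes t :: "'a::euclidean_space"
  assumes "t \<noteq> 0"
  shows "hausdorff_measure DIM('a) (sweep B t) \<le> ennreal (norm t) * hausdorff_measure (DIM('a) - 1) B"
proof -
  obtain e :: 'a where e: "e \<in> Basis" using nonempty_Basis by blast
  then have "norm e = 1" by simp
  from reflection_onto_axis[OF this, of t] obtain f :: "'a \<Rightarrow> 'a" where
    f: "linear f" "\<And>x. f (f x) = x" "\<And>x y. dist (f x) (f y) = dist x y" "f t = norm t *\<^sub>R e" by metis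
  have "sweep B t = f ` sweep (f ` B) (norm t *\<^sub>R e)"
    unfolding f(4)[symmetric] sweep_def
    by (simp add: image_UN image_image linear_add[OF f(1)] linear_scale[OF f(1)] f(2))
  then have "hausdorff_measure DIM('a) (sweep B t) \<le> hausdorff_measure DIM('a) (sweep (f ` B) (norm t *\<^sub>R e))"
    using hausdorff_measure_isometric_image[OF f(3)] by simp
  also have "\<dots> \<le> ennreal (norm t) * hausdorff_measure (DIM('a) - 1) (f ` B)"
    using e assms by (intro hausdorff_measure_sweep_axis) auto
  also have "\<dots> \<le> ennreal (norm t) * hausdorff_measure (DIM('a) - 1) B"
    by (intro mult_left_mono hausdorff_measure_isometric_image f) simp
  finally show ?thesis .
qed

lemma sym_diff_translate_subset_sweep:
  fixes A :: "'a::real_normed_vector set"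
  shows "sym_diff A ((\<lambda>a. a + t) ` A) \<subseteq> sweep (frontier A) t"
proof
  have mem_translate: "y \<in> (\<lambda>a. a + t) ` A \<longleftrightarrow> y - t \<in> A" for y
    by (auto simp: image_iff intro: bexI[of _ "y - t"])
  fix x assume "x \<in> sym_diff A ((\<lambda>a. a + t) ` A)"
  then have "(x \<in> A \<and> x - t \<notin> A) \<or> (x \<notin> A \<and> x - t \<in> A)"
    unfolding Un_iff Diff_iff mem_translate by blast
  then have "closed_segment x (x - t) \<inter> A \<noteq> {}" "closed_segment x (x - t) - A \<noteq> {}" by auto
  then have "closed_segment x (x - t) \<inter> frontier A \<noteq> {}"
    by (intro connected_Int_frontier) auto
  then obtain s where s: "0 \<le> s" "s \<le> 1" "(1 - s) *\<^sub>R x + s *\<^sub>R (x - t) \<in> frontier A"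
    by (auto simp: closed_segment_def)
  moreover have "x = ((1 - s) *\<^sub>R x + s *\<^sub>R (x - t)) + s *\<^sub>R t" by (simp add: algebra_simps)
  ultimately show "x \<in> sweep (frontier A) t" unfolding sweep_def by fastforce
qed

theorem theorem1:
  fixes A :: "'a::euclidean_space set" and t :: 'a
  assumes "bounded A"
  shows "hausdorff_measure DIM('a) (sym_diff A ((\<lambda>a. a + t) ` A))
           \<le> ennreal (norm t) * hausdorff_measure (DIM('a) - 1) (frontier A)"
proof (cases "t = 0")
  \<comment> \<open>The bound for swept sets can fail for \<open>t = 0\<close>: the frontier may have positive volume, and then the
    right-hand side is \<open>0 * \<infinity> = 0\<close>. But here the symmetric difference is empty.\<close>
  case True
  have "hausdorff_measure DIM('a) ({} :: 'a set) \<le> emeasure lborel ({} :: 'a set)"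
    by (rule hausdorff_measure_le_lborel) simp
  then show ?thesis using True by simp
next
  case False
  have "hausdorff_measure DIM('a) (sym_diff A ((\<lambda>a. a + t) ` A)) \<le>
      hausdorff_measure DIM('a) (sweep (frontier A) t)"
    by (rule hausdorff_measure_mono[OF sym_diff_translate_subset_sweep])
  also have "\<dots> \<le> ennreal (norm t) * hausdorff_measure (DIM('a) - 1) (frontier A)"
    by (rule hausdorff_measure_sweep[OF False])
  finally show ?thesis .
qed

end
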